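(* Let $(X,\mathcal B,P)$ be a discrete-time Markov process, let $A\in\mathcal B$ and denote $m:=m(A)$ and $\rho:=\rho(A)$. Then: (i) if $m<\infty$, then $u(\cdot;A)\equiv0$, and for all $n\ge0$ it holds that $\|u_n(\cdot;A)\|\le\rho^{\lfloor n/m\rfloor}$; (ii) if $B\in\mathcal B$ is disjoint from $A$ and $m<\infty$, then for all $n\ge0$ and all $x\in X$ $$0\le w(x;A,B)-w_n(x;A,B)\le\frac{m}{1-\rho}\,\rho^{\lfloor n/m\rfloor}.$$
   Context: $(X,\mathcal B)$ is a measurable space and $P$ a stochastic kernel on it. Let $(\mathbf x_n)_{n\ge0}$ be the Markov process with kernel $P$, $\mathsf P_x$ its law when $\mathbf x_0=x$, and $\tau_D=\inf\{n\ge0:\mathbf x_n\in D\}$ for $D\in\mathcal B$ (with $\inf\emptyset=\infty$). The reach-avoid value functions are $w_n(x;A,B)=\mathsf P_x(\tau_B\le\tau_{A^c},\,\tau_B\le n)$ and $w(x;A,B)=\mathsf P_x(\tau_B\le\tau_{A^c},\,\tau_B<\infty)$. The invariance value functions are $u_n(x;A)=1-w_n(x;X,A^c)=\mathsf P_x(\tau_{A^c}>n)$ and $u(x;A)=1-w(x;X,A^c)=\mathsf P_x(\tau_{A^c}=\infty)$. $\|f\|=\sup_{x\in X}|f(x)|$. Put $m(A)=\inf\{m\ge0:\|u_m(\cdot;A)\|<1\}$ (with $\inf\emptyset=\infty$) and $\rho(A)=\|u_{m(A)}(\cdot;A)\|$, with $\rho(A):=1$ if $m(A)=\infty$. Convention: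 in the degenerate case $A=\emptyset$ (the only case in which $m(A)=0$; then $\rho(A)=0$) the quantity $\rho^{\lfloor n/m\rfloor}$ is read as $0$. The convention $0^0=1$ is used when $\rho=0$ and $m\geq 1$. *)

theory Defs
  imports "HOL-Probability.Probability" "HOL-Library.Extended_Nat"
begin

text \<open>
  A stochastic kernel on a measurable space \<open>M\<close> is a map \<open>K \<in> M \<rightarrow>\<^sub>M prob_algebra M\<close>.
  The law of the Markov process with kernel \<open>K\<close> started at \<open>x\<close> is a measure on the path space
  \<open>PiM UNIV (\<lambda>_. M)\<close>, obtained by the Ionescu-Tulcea construction; the process itself is the
  coordinate process.
\<close>

definition markov_step :: "'a measure \<Rightarrow> ('a \<Rightarrow> 'a measure) \<Rightarrow> 'a \<Rightarrow> nat \<Rightarrow> (nat \<Rightarrow> 'a) \<Rightarrow> 'a measure"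
  where "markov_step M K x i \<omega> = (case i of 0 \<Rightarrow> return M x | Suc j \<Rightarrow> K (\<omega> j))"

definition markov_law :: "'a measure \<Rightarrow> ('a \<Rightarrow> 'a measure) \<Rightarrow> 'a \<Rightarrow> (nat \<Rightarrow> 'a) measure"
  where "markov_law M K x =
    projective_family.lim UNIV (Ionescu_Tulcea.CI (markov_step M K x) (\<lambda>_. M)) (\<lambda>_. M)"

definition hitting_time :: "'a set \<Rightarrow> (nat \<Rightarrow> 'a) \<Rightarrow> enat"
  where "hitting_time D \<omega> = (INF n\<in>{n. \<omega> n \<in> D}. enat n)"

definition reach_avoid_n ::
    "'a measure \<Rightarrow> ('a \<Rightarrow> 'a measure) \<Rightarrow> nat \<Rightarrow> 'a set \<Rightarrow> 'a set \<Rightarrow> 'a \<Rightarrow> real"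
  where "reach_avoid_n M K n A B x = measure (markov_law M K x)
    {\<omega> \<in> space (markov_law M K x).
       hitting_time B \<omega> \<le> hitting_time (space M - A) \<omega> \<and> hitting_time B \<omega> \<le> enat n}"

definition reach_avoid ::
    "'a measure \<Rightarrow> ('a \<Rightarrow> 'a measure) \<Rightarrow> 'a set \<Rightarrow> 'a set \<Rightarrow> 'a \<Rightarrow> real"
  where "reach_avoid M K A B x = measure (markov_law M K x)
    {\<omega> \<in> space (markov_law M K x).
       hitting_time B \<omega> \<le> hitting_time (space M - A) \<omega> \<and> hitting_time B \<omega> < \<infinity>}"

definition invariance_n ::
    "'a measure \<Rightarrow> ('a \<Rightarrow> 'a measure) \<Rightarrow> nat \<Rightarrow> 'a set \<Rightarrow> 'a \<Rightarrow> real"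
  where "invariance_n M K n A x = 1 - reach_avoid_n M K n (space M) (space M - A) x"

definition invariance :: "'a measure \<Rightarrow> ('a \<Rightarrow> 'a measure) \<Rightarrow> 'a set \<Rightarrow> 'a \<Rightarrow> real"
  where "invariance M K A x = 1 - reach_avoid M K (space M) (space M - A) x"

text \<open>
  Intended for bounded \<open>f\<close>, as all value functions are.  The inserted \<open>0\<close> matters only for
  an empty state space, where it gives norm \<open>0\<close> instead of the unspecified real \<open>Sup {}\<close>.
\<close>

definition sup_norm :: "'a measure \<Rightarrow> ('a \<Rightarrow> real) \<Rightarrow> real"
  where "sup_norm M f = Sup (insert 0 ((\<lambda>x. \<bar>f x\<bar>) ` space M))"

definition contraction_time :: "'a measure \<Rightarrow> ('a \<Rightarrow> 'a measure) \<Rightarrow> 'a set \<Rightarrow> enat"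
  where "contraction_time M K A = (INF m\<in>{m. sup_norm M (invariance_n M K m A) < 1}. enat m)"

definition contraction_rate :: "'a measure \<Rightarrow> ('a \<Rightarrow> 'a measure) \<Rightarrow> 'a set \<Rightarrow> real"
  where "contraction_rate M K A =
    (case contraction_time M K A of enat m \<Rightarrow> sup_norm M (invariance_n M K m A) | \<infinity> \<Rightarrow> 1)"

text \<open>
  The quantity \<open>\<rho> ^ \<lfloor>n / m\<rfloor>\<close> for finite \<open>m\<close>, read as \<open>0\<close> when \<open>m = 0\<close> (the case \<open>A = {}\<close>).
  For \<open>m > 0\<close> the convention \<open>0 ^ 0 = 1\<close> is that of HOL.
\<close>

definition block_decay :: "real \<Rightarrow> enat \<Rightarrow> nat \<Rightarrow> real"
  where "block_decay \<rho> m n = (if m = 0 then 0 else \<rho> ^ (n div the_enat m))"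


lemma Ionescu_Tulcea_markov_step:
  assumes K: "K \<in> M \<rightarrow>\<^sub>M prob_algebra M" and x: "x \<in> space M"
  shows "Ionescu_Tulcea (markov_step M K x) (\<lambda>_. M)"
proof (rule Ionescu_Tulcea.intro)
  fix i :: nat
  note [measurable] = measurable_prob_algebraD[OF K]
  show "markov_step M K x i \<in> Pi\<^sub>M {0..<i} (\<lambda>_. M) \<rightarrow>\<^sub>M subprob_algebra M"
  proof (cases i)
    case 0
    then show ?thesis
      using x by (simp add: markov_step_def[abs_def] prob_space.M_in_subprob
          prob_space_return)
  next
    case (Suc j)
    then show ?thesis
      by (simp add: markov_step_def[abs_def])
  qed
next
  fix i and \<omega> :: "nat \<Rightarrow> 'a" assume "\<omega> \<in> space (Pi\<^sub>M {0..<i} (\<lambda>_. M))"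
  then show "prob_space (markov_step M K x i \<omega>)"
    using x measurable_space[OF K]
    by (auto simp: markov_step_def space_prob_algebra space_PiM PiE_iff prob_space_return
        split: nat.split)
qed

lemma
  assumes K: "K \<in> M \<rightarrow>\<^sub>M prob_algebra M" and x: "x \<in> space M"
  shows prob_space_markov_law: "prob_space (markov_law M K x)"
    and sets_markov_law: "sets (markov_law M K x) = sets (Pi\<^sub>M UNIV (\<lambda>_. M))"
proof -
  interpret Ionescu_Tulcea "markov_step M K x" "\<lambda>_. M"
    by (rule Ionescu_Tulcea_markov_step[OF K x])
  show "prob_space (markov_law M K x)"
    using lim[of "{}" "{\<lambda>_. undefined}"] PF.prob_space_P[of "{}"]
    by (intro prob_spaceI)
       (auto simp: markov_law_def CI_def up_to_def PiM_empty prod_emb_def space_PiM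
         emeasure_distr restrict_def)
  show "sets (markov_law M K x) = sets (Pi\<^sub>M UNIV (\<lambda>_. M))"
    unfolding markov_law_def by (rule PF.sets_lim)
qed

lemma hitting_time_le_iff: "hitting_time D \<omega> \<le> enat n \<longleftrightarrow> (\<exists>k\<le>n. \<omega> k \<in> D)"
proof
  assume "hitting_time D \<omega> \<le> enat n"
  then have "hitting_time D \<omega> < enat (Suc n)"
    by (metis enat_ord_simps(2) lessI order.strict_trans1)
  then show "\<exists>k\<le>n. \<omega> k \<in> D"
    by (auto simp: hitting_time_def INF_less_iff less_Suc_eq_le)
next
  assume "\<exists>k\<le>n. \<omega> k \<in> D"
  then show "hitting_time D \<omega> \<le> enat n"
    by (auto simp: hitting_time_def intro: INF_lower2)
qed

lemma hitting_time_less_infinity_iff: "hitting_time D \<omega> < \<infinity> \<longleftrightarrow> (\<exists>k. \<omega> k \<in> D)"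
  unfolding hitting_time_def INF_less_iff by auto

lemma hitting_time_empty [simp]: "hitting_time {} \<omega> = \<infinity>"
  using hitting_time_less_infinity_iff[of "{}" \<omega>] by simp

lemma
  assumes K: "K \<in> M \<rightarrow>\<^sub>M prob_algebra M" and A: "A \<in> sets M" and x: "x \<in> space M"
  shows invariance_n_eq: "invariance_n M K n A x = measure (markov_law M K x)
      {\<omega> \<in> space (markov_law M K x). enat n < hitting_time (space M - A) \<omega>}"
    and invariance_eq: "invariance M K A x = measure (markov_law M K x)
      {\<omega> \<in> space (markov_law M K x). hitting_time (space M - A) \<omega> = \<infinity>}"
proof -
  interpret prob_space "markov_law M K x" by (rule prob_space_markov_law[OF K x])
  note [measurable_cong] = sets_markov_law[OF K x]
  note [measurable] = A
  have ev: "{\<omega> \<in> space (markov_law M K x). \<exists>k\<le>n. \<omega> k \<in> space M - A} \<in> events"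
    by measurable
  show "invariance_n M K n A x = measure (markov_law M K x)
      {\<omega> \<in> space (markov_law M K x). enat n < hitting_time (space M - A) \<omega>}"
    unfolding not_le[symmetric] hitting_time_le_iff prob_neg[OF ev]
    by (simp add: invariance_n_def reach_avoid_n_def hitting_time_le_iff)
  have ev: "{\<omega> \<in> space (markov_law M K x). \<exists>k. \<omega> k \<in> space M - A} \<in> events"
    by measurable
  have "hitting_time (space M - A) \<omega> = \<infinity> \<longleftrightarrow> \<not> (\<exists>k. \<omega> k \<in> space M - A)" for \<omega>
    using hitting_time_less_infinity_iff[of "space M - A" \<omega>] by auto
  then show "invariance M K A x = measure (markov_law M K x)
      {\<omega> \<in> space (markov_law M K x). hitting_time (space M - A) \<omega> = \<infinity>}"
    unfolding hitting_time_less_infinity_iff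
    by (simp only: prob_neg[OF ev] invariance_def reach_avoid_def
        hitting_time_less_infinity_iff Diff_cancel hitting_time_empty) simp
qed

end

theory Submission
  imports Defs
begin

text \<open>
  The function \<open>u\<^sub>n\<close> is the \<open>n\<close>-th iterate, on the indicator of \<open>A\<close>, of the monotone and
  homogeneous operator \<open>T f x = 1\<^sub>A(x) * \<integral> f dK(x)\<close>. As \<open>u\<^sub>m \<le> \<rho> * 1\<^sub>A\<close>, applying \<open>T\<^sup>n\<close> gives
  \<open>u\<^bsub>n+m\<^esub> \<le> \<rho> * u\<^sub>n\<close>, hence geometric decay. For (ii), a path counted by \<open>w\<close> but not by \<open>w\<^sub>n\<close>
  has \<open>n < \<tau>\<^sub>B \<le> \<tau>\<close> with \<open>\<tau>\<close> the exit time from \<open>A\<close>, so \<open>w - w\<^sub>n \<le> u\<^sub>n\<close>, and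
  \<open>1 \<le> m / (1 - \<rho>)\<close> when \<open>m \<ge> 1\<close>; the case \<open>m = 0\<close> forces \<open>A = {}\<close>.
\<close>

section \<open>One-step operator of the killed process and its iterates\<close>

definition killed_step :: "('a \<Rightarrow> 'a measure) \<Rightarrow> 'a set \<Rightarrow> ('a \<Rightarrow> ennreal) \<Rightarrow> 'a \<Rightarrow> ennreal"
  where "killed_step K A f x = indicator A x * (\<integral>\<^sup>+y. f y \<partial>K x)"

context
  fixes M :: "'a measure" and K :: "'a \<Rightarrow> 'a measure" and A :: "'a set"
  assumes K: "K \<in> M \<rightarrow>\<^sub>M prob_algebra M" and A: "A \<in> sets M"
begin

lemma
  assumes "x \<in> space M"
  shows sets_kernel: "sets (K x) = sets M"
    and space_kernel: "space (K x) = space M"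
proof -
  show *: "sets (K x) = sets M"
    using measurable_space[OF K assms] by (simp add: space_prob_algebra)
  show "space (K x) = space M"
    by (rule sets_eq_imp_space_eq[OF *])
qed

lemma measurable_killed_step [measurable]:
  assumes f: "f \<in> borel_measurable M"
  shows "killed_step K A f \<in> borel_measurable M"
proof -
  have "(\<lambda>x. \<integral>\<^sup>+y. f y \<partial>K x) \<in> borel_measurable M"
    using measurable_compose[OF measurable_prob_algebraD[OF K]
        nn_integral_measurable_subprob_algebra[OF f]] .
  then show ?thesis
    unfolding killed_step_def[abs_def]
    by (intro borel_measurable_times_ennreal borel_measurable_indicator A)
qed

lemma killed_step_mono:
  assumes "x \<in> space M" and "\<And>y. y \<in> space M \<Longrightarrow> f y \<le> g y"
  shows "killed_step K A f x \<le> killed_step K A g x"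
  unfolding killed_step_def
  by (intro mult_left_mono nn_integral_mono) (use assms in \<open>auto simp: space_kernel\<close>)

lemma killed_step_cmult:
  assumes "x \<in> space M" and f: "f \<in> borel_measurable M"
  shows "killed_step K A (\<lambda>y. c * f y) x = c * killed_step K A f x"
proof -
  have "f \<in> borel_measurable (K x)"
    using f by (simp only: measurable_cong_sets[OF sets_kernel[OF assms(1)] refl])
  then show ?thesis
    by (simp add: killed_step_def nn_integral_cmult mult.left_commute)
qed

lemma measurable_killed_step_funpow [measurable]:
  "f \<in> borel_measurable M \<Longrightarrow> (killed_step K A ^^ n) f \<in> borel_measurable M"
  by (induction n) (simp_all only: funpow.simps comp_apply id_apply measurable_killed_step)

lemma killed_step_funpow_mono:
  assumes "x \<in> space M" and "\<And>y. y \<in> space M \<Longrightarrow> f y \<le> g y"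
  shows "(killed_step K A ^^ n) f x \<le> (killed_step K A ^^ n) g x"
  using assms(1)
proof (induction n arbitrary: x)
  case 0
  then show ?case using assms(2) by simp
next
  case (Suc n)
  then show ?case
    unfolding funpow.simps comp_apply by (intro killed_step_mono)
qed

lemma killed_step_funpow_cmult:
  assumes f: "f \<in> borel_measurable M" and "x \<in> space M"
  shows "(killed_step K A ^^ n) (\<lambda>y. c * f y) x = c * (killed_step K A ^^ n) f x"
  using assms(2)
proof (induction n arbitrary: x)
  case (Suc n)
  \<comment> \<open>The induction hypothesis is an equality on \<open>space M\<close> only, so it is
    applied pointwise under the integral; the two iterates need not agree as functions.\<close>
  have "killed_step K A ((killed_step K A ^^ n) (\<lambda>y. c * f y)) x
      = killed_step K A (\<lambda>y. c * (killed_step K A ^^ n) f y) x"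
    using Suc unfolding killed_step_def[of K A _ x]
    by (intro arg_cong2[where f="(*)"] refl nn_integral_cong) (simp add: space_kernel)
  then show ?case
    unfolding funpow.simps comp_apply
    by (simp only: killed_step_cmult[OF Suc.prems measurable_killed_step_funpow[OF f]])
qed simp

text \<open>For \<open>n = 0\<close> this is the indicator itself; for larger \<open>n\<close> the
  outermost operator contributes the factor \<open>indicator A x\<close>.\<close>

lemma killed_step_funpow_outside:
  "x \<notin> A \<Longrightarrow> (killed_step K A ^^ n) (indicator A) x = 0"
  by (cases n) (simp_all add: killed_step_def)

section \<open>Path law: u_n as an iterate of the operator\<close>

text \<open>The measure is the joint law of the coordinates 0 to \<open>n\<close>. The operator
  tests a position before moving on, so \<open>n\<close> iterations test times 0 to n - 1 and leave
  the state at time \<open>n\<close> to \<open>f\<close>. Integrating out the last coordinate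
  replaces \<open>f\<close> by \<open>killed_step K A f\<close>, which is why \<open>f\<close> is
  general in the induction.\<close>

lemma nn_integral_markov_prefix:
  assumes x: "x \<in> space M" and f: "f \<in> borel_measurable M"
  shows "(\<integral>\<^sup>+\<omega>. (if \<forall>k<n. \<omega> k \<in> A then f (\<omega> n) else 0)
      \<partial>Ionescu_Tulcea.C (markov_step M K x) (\<lambda>_. M) 0 (Suc n) (\<lambda>_. undefined))
    = (killed_step K A ^^ n) f x"
  using f
proof (induction n arbitrary: f)
  interpret Ionescu_Tulcea "markov_step M K x" "\<lambda>_. M"
    by (rule Ionescu_Tulcea_markov_step[OF K x])
  note [measurable] = A
  have u: "(\<lambda>_. undefined) \<in> space (Pi\<^sub>M {0..<0::nat} (\<lambda>_. M))"
    by (simp add: space_PiM)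
  {
    case 0
    note [measurable] = 0
    have "(\<lambda>\<omega>. f (\<omega> 0)) \<in> borel_measurable (Pi\<^sub>M {0..<Suc 0} (\<lambda>_. M))"
      by measurable
    \<comment> \<open>The joint law of the single coordinate 0 is the initial step,
      \<open>return M x\<close>, bound to the point mass at the empty history.\<close>
    then have "(\<integral>\<^sup>+\<omega>. f (\<omega> 0) \<partial>C 0 (Suc 0) (\<lambda>_. undefined))
        = (\<integral>\<^sup>+y. f y \<partial>markov_step M K x 0 (\<lambda>_. undefined))"
      unfolding C.simps add_0 bind_return[OF measurable_eP u] by (subst nn_integral_eP[OF u]) simp_all
    also have "\<dots> = f x"
      using 0 x by (simp add: markov_step_def nn_integral_return)
    finally show ?case
      by (simp del: C.simps)
  next
    case (Suc n)
    note [measurable] = Suc.prems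
    have *: "(\<lambda>\<omega>. if \<forall>k<Suc n. \<omega> k \<in> A then f (\<omega> (Suc n)) else 0)
        \<in> borel_measurable (Pi\<^sub>M {0..<Suc (Suc n)} (\<lambda>_. M))"
      by measurable
    \<comment> \<open>Given the history up to time \<open>n\<close>, the new coordinate has law
      \<open>K (\<omega> n)\<close>; the test at time \<open>n\<close> becomes the indicator inside
      \<open>killed_step\<close>.\<close>
    have inner: "(\<integral>\<^sup>+\<omega>'. (if \<forall>k<Suc n. \<omega>' k \<in> A then f (\<omega>' (Suc n)) else 0) \<partial>eP (Suc n) \<omega>)
        = (if \<forall>k<n. \<omega> k \<in> A then killed_step K A f (\<omega> n) else 0)"
      if \<omega>: "\<omega> \<in> space (Pi\<^sub>M {0..<Suc n} (\<lambda>_. M))" for \<omega>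
    proof -
      have "(\<integral>\<^sup>+\<omega>'. (if \<forall>k<Suc n. \<omega>' k \<in> A then f (\<omega>' (Suc n)) else 0) \<partial>eP (Suc n) \<omega>)
          = (\<integral>\<^sup>+y. (if \<forall>k<Suc n. \<omega> k \<in> A then f y else 0) \<partial>K (\<omega> n))"
        by (subst nn_integral_eP[OF \<omega> *])
           (auto simp: markov_step_def intro!: nn_integral_cong)
      also have "\<dots> = (if \<forall>k<n. \<omega> k \<in> A then killed_step K A f (\<omega> n) else 0)"
      proof (cases "\<forall>k<Suc n. \<omega> k \<in> A")
        case True
        then show ?thesis by (simp add: killed_step_def)
      next
        case False
        \<comment> \<open>Either a test before time \<open>n\<close> fails, or the one at time
          \<open>n\<close> does and the indicator inside \<open>killed_step\<close>
          vanishes.\<close>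
        then have "\<omega> n \<notin> A" if "\<forall>k<n. \<omega> k \<in> A"
          using that by (auto simp: less_Suc_eq)
        then have "(if \<forall>k<n. \<omega> k \<in> A then killed_step K A f (\<omega> n) else 0) = 0"
          by (simp add: killed_step_def)
        then show ?thesis
          by (simp only: False if_False nn_integral_const mult_zero_left)
      qed
      finally show ?thesis .
    qed
    have "(\<integral>\<^sup>+\<omega>. (if \<forall>k<Suc n. \<omega> k \<in> A then f (\<omega> (Suc n)) else 0)
          \<partial>C 0 (Suc (Suc n)) (\<lambda>_. undefined))
        = (\<integral>\<^sup>+\<omega>. (\<integral>\<^sup>+\<omega>'. (if \<forall>k<Suc n. \<omega>' k \<in> A then f (\<omega>' (Suc n)) else 0) \<partial>eP (Suc n) \<omega>)
          \<partial>C 0 (Suc n) (\<lambda>_. undefined))"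
      unfolding C.simps(2)[of 0 "Suc n"] add_0
    proof (rule nn_integral_bind[OF *])
      show "eP (Suc n) \<in> C 0 (Suc n) (\<lambda>_. undefined)
          \<rightarrow>\<^sub>M subprob_algebra (Pi\<^sub>M {0..<Suc (Suc n)} (\<lambda>_. M))"
        unfolding measurable_cong_sets[OF sets_C[OF u] refl] add_0 by (rule measurable_eP)
    qed
    also have "\<dots> = (\<integral>\<^sup>+\<omega>. (if \<forall>k<n. \<omega> k \<in> A then killed_step K A f (\<omega> n) else 0)
          \<partial>C 0 (Suc n) (\<lambda>_. undefined))"
      by (intro nn_integral_cong inner) (simp add: space_C[OF u] del: C.simps)
    also have "\<dots> = (killed_step K A ^^ n) (killed_step K A f) x"
      by (rule Suc.IH) measurable
    finally show ?case
      by (simp add: funpow_swap1)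
  }
qed

lemma invariance_n_eq_stay:
  assumes x: "x \<in> space M"
  shows "invariance_n M K n A x
    = measure (markov_law M K x) {\<omega> \<in> space (markov_law M K x). \<forall>k\<le>n. \<omega> k \<in> A}"
proof -
  \<comment> \<open>Coordinates lie in \<open>space M\<close>, so avoiding
    \<open>space M - A\<close> means lying in \<open>A\<close>.\<close>
  have "\<omega> k \<in> space M" if "\<omega> \<in> space (markov_law M K x)" for \<omega> k
    using that sets_eq_imp_space_eq[OF sets_markov_law[OF K x]] by (auto simp: space_PiM)
  then show ?thesis
    unfolding invariance_n_eq[OF K A x] not_le[symmetric] hitting_time_le_iff
    by (intro arg_cong[where f="measure _"]) auto
qed

text \<open>Staying in \<open>A\<close> up to time \<open>n\<close> is a cylinder event with base
  \<open>X\<close> over the coordinates 0 to \<open>n\<close>. The projective limit gives it the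
  mass of \<open>X\<close> under the finite-dimensional law, where the prefix formula
  applies.\<close>

lemma invariance_n_eq_funpow:
  assumes x: "x \<in> space M"
  shows "ennreal (invariance_n M K n A x) = (killed_step K A ^^ n) (indicator A) x"
proof -
  interpret Ionescu_Tulcea "markov_step M K x" "\<lambda>_. M"
    by (rule Ionescu_Tulcea_markov_step[OF K x])
  interpret L: prob_space "markov_law M K x" by (rule prob_space_markov_law[OF K x])
  note [measurable] = A
  have u: "(\<lambda>_. undefined) \<in> space (Pi\<^sub>M {0..<0::nat} (\<lambda>_. M))"
    by (simp add: space_PiM)
  let ?J = "{0..<Suc n}"
  define X where "X = {\<omega> \<in> space (Pi\<^sub>M ?J (\<lambda>_. M)). \<forall>k\<in>?J. \<omega> k \<in> A}"
  have X[measurable]: "X \<in> sets (Pi\<^sub>M ?J (\<lambda>_. M))"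
    unfolding X_def by measurable
  have sp: "space (markov_law M K x) = space (Pi\<^sub>M UNIV (\<lambda>_. M))"
    by (rule sets_eq_imp_space_eq[OF sets_markov_law[OF K x]])
  have "{\<omega> \<in> space (markov_law M K x). \<forall>k\<le>n. \<omega> k \<in> A} = PF.emb UNIV ?J X"
    unfolding sp by (auto simp: X_def prod_emb_def space_PiM less_Suc_eq_le)
  then have "ennreal (invariance_n M K n A x) = emeasure (markov_law M K x) (PF.emb UNIV ?J X)"
    by (simp add: invariance_n_eq_stay[OF x] L.emeasure_eq_measure)
  also have "\<dots> = emeasure (C 0 (Suc n) (\<lambda>_. undefined)) X"
    unfolding markov_law_def
    by (subst lim) (use X sets.sets_into_space[OF X] in
      \<open>simp_all add: emeasure_CI[of ?J "Suc n"] prod_emb_id space_PiM del: C.simps\<close>)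
  also have "\<dots> = (\<integral>\<^sup>+\<omega>. indicator X \<omega> \<partial>C 0 (Suc n) (\<lambda>_. undefined))"
    using X by (subst nn_integral_indicator) (simp_all add: sets_C[OF u] del: C.simps)
  \<comment> \<open>The test at the final time is split off and serves as
    \<open>f = indicator A\<close> in the prefix formula.\<close>
  also have "\<dots> = (\<integral>\<^sup>+\<omega>. (if \<forall>k<n. \<omega> k \<in> A then indicator A (\<omega> n) else 0)
      \<partial>C 0 (Suc n) (\<lambda>_. undefined))"
    by (intro nn_integral_cong)
       (auto simp: X_def space_C[OF u] less_Suc_eq split: split_indicator simp del: C.simps)
  also have "\<dots> = (killed_step K A ^^ n) (indicator A) x"
    by (rule nn_integral_markov_prefix[OF x]) measurable
  finally show ?thesis .
qed

section \<open>Bounds on u_n and its sup norm\<close>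

lemma
  assumes x: "x \<in> space M"
  shows invariance_n_nonneg: "0 \<le> invariance_n M K n A x"
    and invariance_n_le_1: "invariance_n M K n A x \<le> 1"
proof -
  interpret L: prob_space "markov_law M K x" by (rule prob_space_markov_law[OF K x])
  show "0 \<le> invariance_n M K n A x" "invariance_n M K n A x \<le> 1"
    by (simp_all add: invariance_n_eq_stay[OF x])
qed

lemma invariance_n_antimono:
  assumes x: "x \<in> space M" and "k \<le> n"
  shows "invariance_n M K n A x \<le> invariance_n M K k A x"
proof -
  interpret L: prob_space "markov_law M K x" by (rule prob_space_markov_law[OF K x])
  note [measurable_cong] = sets_markov_law[OF K x]
  note [measurable] = A
  show ?thesis
    unfolding invariance_n_eq_stay[OF x]
    by (rule L.finite_measure_mono) (use \<open>k \<le> n\<close> in \<open>auto, measurable\<close>)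
qed

lemma invariance_n_le_sup_norm:
  assumes x: "x \<in> space M"
  shows "invariance_n M K n A x \<le> sup_norm M (invariance_n M K n A)"
  unfolding sup_norm_def
proof (rule order_trans[OF abs_ge_self cSup_upper])
  show "bdd_above (insert 0 ((\<lambda>x. \<bar>invariance_n M K n A x\<bar>) ` space M))"
    by (intro bdd_aboveI[of _ 1]) (auto simp: invariance_n_le_1 invariance_n_nonneg)
qed (use x in auto)

text \<open>The premise \<open>0 \<le> c\<close> accounts for the 0 inserted in
  \<open>sup_norm\<close>.\<close>

lemma sup_norm_invariance_n_leI:
  assumes "\<And>x. x \<in> space M \<Longrightarrow> invariance_n M K n A x \<le> c" and "0 \<le> c"
  shows "sup_norm M (invariance_n M K n A) \<le> c"
  unfolding sup_norm_def
  by (rule cSup_least) (use assms in \<open>auto simp: invariance_n_nonneg\<close>)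

lemma sup_norm_invariance_n_nonneg: "0 \<le> sup_norm M (invariance_n M K n A)"
  unfolding sup_norm_def
  by (intro cSup_upper bdd_aboveI[of _ 1]) (auto simp: invariance_n_le_1 invariance_n_nonneg)

lemma invariance_n_add_le:
  assumes x: "x \<in> space M"
  shows "invariance_n M K (n + m) A x
    \<le> sup_norm M (invariance_n M K m A) * invariance_n M K n A x"
proof -
  let ?c = "sup_norm M (invariance_n M K m A)"
  note [measurable] = A
  \<comment> \<open>On \<open>A\<close> this is the norm bound, off \<open>A\<close> both sides
    vanish. Keeping the indicator on the right makes the \<open>n\<close>-th iterate of the bound a
    multiple of u_n rather than of the iterate on the constant 1.\<close>
  have "(killed_step K A ^^ m) (indicator A) y \<le> ennreal ?c * indicator A y"
    if "y \<in> space M" for y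
    using invariance_n_le_sup_norm[OF that, of m] killed_step_funpow_outside[of y m]
    by (auto simp: invariance_n_eq_funpow[OF that, symmetric] ennreal_leI split: split_indicator)
  then have "(killed_step K A ^^ n) ((killed_step K A ^^ m) (indicator A)) x
      \<le> (killed_step K A ^^ n) (\<lambda>y. ennreal ?c * indicator A y) x"
    by (rule killed_step_funpow_mono[OF x])
  also have "\<dots> = ennreal ?c * (killed_step K A ^^ n) (indicator A) x"
    by (rule killed_step_funpow_cmult[OF _ x]) measurable
  finally have "ennreal (invariance_n M K (n + m) A x) \<le> ennreal (?c * invariance_n M K n A x)"
    by (simp add: invariance_n_eq_funpow[OF x] funpow_add ennreal_mult
        invariance_n_nonneg[OF x] sup_norm_invariance_n_nonneg)
  then show ?thesis
    by (simp add: invariance_n_nonneg[OF x] sup_norm_invariance_n_nonneg ennreal_le_iff)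
qed

lemma invariance_n_mult_le:
  assumes x: "x \<in> space M"
  shows "invariance_n M K (k * m) A x \<le> sup_norm M (invariance_n M K m A) ^ k"
proof (induction k)
  case 0
  then show ?case by (simp add: invariance_n_le_1[OF x])
next
  case (Suc k)
  have "invariance_n M K (Suc k * m) A x
      \<le> sup_norm M (invariance_n M K m A) * invariance_n M K (k * m) A x"
    using invariance_n_add_le[OF x, of "k * m" m] by (simp add: add.commute)
  also have "\<dots> \<le> sup_norm M (invariance_n M K m A) ^ Suc k"
    using Suc by (simp add: mult_left_mono sup_norm_invariance_n_nonneg)
  finally show ?case .
qed

section \<open>Contraction time and geometric decay\<close>

text \<open>A finite infimum in \<open>enat\<close> comes from a nonempty set and is attained by
  well-ordering, so the defining strict inequality holds at \<open>m\<close> itself.\<close>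

lemma contraction_timeD:
  assumes "contraction_time M K A = enat m"
  shows "contraction_rate M K A = sup_norm M (invariance_n M K m A)"
    and "contraction_rate M K A < 1"
proof -
  show *: "contraction_rate M K A = sup_norm M (invariance_n M K m A)"
    using assms by (simp add: contraction_rate_def)
  let ?S = "{m. sup_norm M (invariance_n M K m A) < 1}"
  have "?S \<noteq> {}"
  proof
    assume "?S = {}"
    then have "contraction_time M K A = Inf {}"
      unfolding contraction_time_def by (simp only: image_empty)
    then show False
      using assms by (simp add: top_enat_def)
  qed
  then have "Inf (enat ` ?S) \<in> enat ` ?S"
    by (intro wellorder_InfI[of "enat (SOME m. m \<in> ?S)"]) (auto intro: someI2_ex)
  then show "contraction_rate M K A < 1"
    using assms unfolding * contraction_time_def by auto
qed

text \<open>u_0 is the indicator of \<open>A\<close>, so any point of \<open>A\<close> forces its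
  norm up to 1.\<close>

lemma contraction_time_0_imp_empty:
  assumes "contraction_time M K A = 0"
  shows "A = {}"
proof (rule ccontr)
  assume "A \<noteq> {}"
  then obtain x where x: "x \<in> A" "x \<in> space M"
    using sets.sets_into_space[OF A] by auto
  have "ennreal (invariance_n M K 0 A x) = 1"
    using x by (simp add: invariance_n_eq_funpow)
  then have "1 \<le> sup_norm M (invariance_n M K 0 A)"
    using invariance_n_le_sup_norm[OF x(2), of 0] by simp
  then show False
    using contraction_timeD[of 0] assms by (simp add: zero_enat_def)
qed

lemma invariance_n_le_block_decay:
  assumes m: "contraction_time M K A = enat m" and x: "x \<in> space M"
  shows "invariance_n M K n A x \<le> block_decay (contraction_rate M K A) (enat m) n"
proof (cases "m = 0")
  case True
  then have "A = {}"
    using m contraction_time_0_imp_empty by (simp add: zero_enat_def)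
  then have "{\<omega> \<in> space (markov_law M K x). \<forall>k\<le>n. \<omega> k \<in> A} = {}"
    by blast
  then have "invariance_n M K n A x = 0"
    by (simp only: invariance_n_eq_stay[OF x] measure_empty)
  then show ?thesis
    using True by (simp add: block_decay_def zero_enat_def)
next
  case False
  \<comment> \<open>Going back to the last multiple of \<open>m\<close> leaves
    \<open>n div m\<close> full blocks, each contributing one factor of the rate.\<close>
  have "invariance_n M K n A x \<le> invariance_n M K (n div m * m) A x"
    by (rule invariance_n_antimono[OF x]) simp
  also have "\<dots> \<le> contraction_rate M K A ^ (n div m)"
    unfolding contraction_timeD[OF m] by (rule invariance_n_mult_le[OF x])
  finally show ?thesis
    using False by (simp add: block_decay_def zero_enat_def)
qed

lemma contraction_rate_nonneg: "0 \<le> contraction_rate M K A"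
  by (auto simp: contraction_rate_def sup_norm_invariance_n_nonneg split: enat.split)

lemma block_decay_contraction_rate_nonneg: "0 \<le> block_decay (contraction_rate M K A) m n"
  by (simp add: block_decay_def contraction_rate_nonneg)

text \<open>u lies below u_n at every multiple \<open>k * m\<close>, hence below the
  \<open>k\<close>-th power of a rate less than 1. Using powers instead of
  \<open>block_decay\<close> also covers \<open>m = 0\<close>.\<close>

lemma invariance_eq_0:
  assumes m: "contraction_time M K A = enat m" and x: "x \<in> space M"
  shows "invariance M K A x = 0"
proof (rule antisym)
  interpret L: prob_space "markov_law M K x" by (rule prob_space_markov_law[OF K x])
  note [measurable_cong] = sets_markov_law[OF K x]
  note [measurable] = A
  let ?\<rho> = "contraction_rate M K A"
  show "0 \<le> invariance M K A x"
    by (simp add: invariance_eq[OF K A x])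
  have le: "invariance M K A x \<le> invariance_n M K n A x" for n
    unfolding invariance_eq[OF K A x] invariance_n_eq[OF K A x]
  proof (rule L.finite_measure_mono)
    show "{\<omega> \<in> space (markov_law M K x). enat n < hitting_time (space M - A) \<omega>} \<in> L.events"
      unfolding not_le[symmetric] hitting_time_le_iff by measurable
  qed auto
  have "invariance M K A x \<le> ?\<rho> ^ k" for k
    using le[of "k * m"] invariance_n_mult_le[OF x, of k m] contraction_timeD(1)[OF m] by simp
  moreover have "(\<lambda>k. ?\<rho> ^ k) \<longlonglongrightarrow> 0"
    using contraction_rate_nonneg contraction_timeD(2)[OF m] by (intro LIMSEQ_power_zero) auto
  ultimately show "invariance M K A x \<le> 0"
    by (intro LIMSEQ_le_const) auto
qed

section \<open>Reach-avoid functions and the final bound\<close>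

lemma
  assumes x: "x \<in> space M" and B: "B \<in> sets M"
  shows reach_avoid_n_le_reach_avoid: "reach_avoid_n M K n A B x \<le> reach_avoid M K A B x"
    and reach_avoid_diff_le_invariance_n:
      "reach_avoid M K A B x - reach_avoid_n M K n A B x \<le> invariance_n M K n A x"
proof -
  interpret L: prob_space "markov_law M K x" by (rule prob_space_markov_law[OF K x])
  note [measurable_cong] = sets_markov_law[OF K x]
  note [measurable] = A B
  let ?L = "markov_law M K x" and ?hB = "hitting_time B" and ?hA = "hitting_time (space M - A)"
  \<comment> \<open>Comparing the two times through their finite upper bounds turns the event into a
    countable combination of coordinate conditions, so its measurability is automatic.\<close>
  have "?hB \<omega> \<le> ?hA \<omega> \<longleftrightarrow> (\<forall>n. ?hA \<omega> \<le> enat n \<longrightarrow> ?hB \<omega> \<le> enat n)" for \<omega>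
    by (cases "?hA \<omega>") (auto intro: order_trans)
  then have le_iff: "?hB \<omega> \<le> ?hA \<omega>
      \<longleftrightarrow> (\<forall>n. (\<exists>k\<le>n. \<omega> k \<in> space M - A) \<longrightarrow> (\<exists>k\<le>n. \<omega> k \<in> B))" for \<omega>
    unfolding hitting_time_le_iff .
  have ev: "{\<omega> \<in> space ?L. ?hB \<omega> \<le> ?hA \<omega> \<and> ?hB \<omega> < \<infinity>} \<in> L.events"
    unfolding le_iff hitting_time_less_infinity_iff by measurable
  have ev_n: "{\<omega> \<in> space ?L. ?hB \<omega> \<le> ?hA \<omega> \<and> ?hB \<omega> \<le> enat n} \<in> L.events"
    unfolding le_iff hitting_time_le_iff by measurable
  have ev_u: "{\<omega> \<in> space ?L. enat n < ?hA \<omega>} \<in> L.events"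
    unfolding not_le[symmetric] hitting_time_le_iff by measurable
  show "reach_avoid_n M K n A B x \<le> reach_avoid M K A B x"
    unfolding reach_avoid_n_def reach_avoid_def
    by (rule L.finite_measure_mono[OF _ ev]) (auto dest: order.strict_trans1)
  have early_or_stay: "?hB \<omega> \<le> enat n \<or> enat n < ?hA \<omega>" if "?hB \<omega> \<le> ?hA \<omega>" for \<omega>
    using that by (meson le_less_linear order_trans)
  \<comment> \<open>The events of w_n and u_n may overlap; their union covers that of w, and
    subadditivity suffices.\<close>
  have "reach_avoid M K A B x \<le> measure ?L ({\<omega> \<in> space ?L. ?hB \<omega> \<le> ?hA \<omega> \<and> ?hB \<omega> \<le> enat n}
      \<union> {\<omega> \<in> space ?L. enat n < ?hA \<omega>})"
    unfolding reach_avoid_def using ev_n ev_u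
    by (intro L.finite_measure_mono sets.Un) (use early_or_stay in blast)+
  also have "\<dots> \<le> reach_avoid_n M K n A B x + invariance_n M K n A x"
    unfolding reach_avoid_n_def invariance_n_eq[OF K A x]
    by (rule measure_Un_le[OF ev_n ev_u])
  finally show "reach_avoid M K A B x - reach_avoid_n M K n A B x \<le> invariance_n M K n A x"
    by simp
qed

lemma block_decay_le_scaled:
  assumes m: "contraction_time M K A = enat m"
  shows "block_decay (contraction_rate M K A) (enat m) n
    \<le> real m / (1 - contraction_rate M K A) * block_decay (contraction_rate M K A) (enat m) n"
proof (cases "m = 0")
  case True
  \<comment> \<open>Here the factor \<open>real m\<close> is 0, but \<open>block_decay\<close> is 0
    as well.\<close>
  then show ?thesis by (simp add: block_decay_def zero_enat_def)
next
  case False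
  then have "1 \<le> real m / (1 - contraction_rate M K A)"
    using contraction_timeD(2)[OF m] contraction_rate_nonneg by (simp add: field_simps)
  from mult_right_mono[OF this block_decay_contraction_rate_nonneg] show ?thesis
    unfolding mult_1_left .
qed

end

theorem proposition2:
  fixes M :: "'a measure" and K :: "'a \<Rightarrow> 'a measure" and A :: "'a set"
    and m :: enat and \<rho> :: real
  assumes "K \<in> M \<rightarrow>\<^sub>M prob_algebra M"
    and "A \<in> sets M"
    and "m = contraction_time M K A"
    and "\<rho> = contraction_rate M K A"
  shows "(m < \<infinity> \<longrightarrow>
            (\<forall>x\<in>space M. invariance M K A x = 0) \<and>
            (\<forall>n. sup_norm M (invariance_n M K n A) \<le> block_decay \<rho> m n)) \<and>
         (\<forall>B\<in>sets M. A \<inter> B = {} \<and> m < \<infinity> \<longrightarrow>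
            (\<forall>n. \<forall>x\<in>space M.
               0 \<le> reach_avoid M K A B x - reach_avoid_n M K n A B x \<and>
               reach_avoid M K A B x - reach_avoid_n M K n A B x
                 \<le> real (the_enat m) / (1 - \<rho>) * block_decay \<rho> m n))"
proof (cases m)
  case (enat k)
  note KA = assms(1,2)
  have k: "contraction_time M K A = enat k"
    using enat assms(3) by simp
  have "sup_norm M (invariance_n M K n A) \<le> block_decay \<rho> m n" for n
    unfolding assms(4) enat
    by (intro sup_norm_invariance_n_leI[OF KA] invariance_n_le_block_decay[OF KA k]
        block_decay_contraction_rate_nonneg[OF KA])
  \<comment> \<open>Chain: w - w_n is at most u_n, which is at most the block decay, and this at
    most its scaled form.\<close>
  moreover have "reach_avoid M K A B x - reach_avoid_n M K n A B x
      \<le> real (the_enat m) / (1 - \<rho>) * block_decay \<rho> m n"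
    if "B \<in> sets M" "x \<in> space M" for B n x
    using reach_avoid_diff_le_invariance_n[OF KA that(2,1), of n]
      invariance_n_le_block_decay[OF KA k that(2), of n] block_decay_le_scaled[OF KA k, of n]
    unfolding assms(4) enat by simp
  ultimately show ?thesis
    using invariance_eq_0[OF KA k] reach_avoid_n_le_reach_avoid[OF KA] by simp
\<comment> \<open>For \<open>m = \<infinity>\<close> both claims are vacuous.\<close>
qed simp

end
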